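(* Let $X$ and $Y$ be topological spaces, let $\mathcal{F}$ be a closed cover of $X$ that is locally finite and locally finite dimensional, let $\mathcal{G}$ be an $AE(X)$-cover of $Y$, and let $C \colon \mathcal{F} \to \mathcal{G}$ be a carrier. Then each map carried by $C$ (defined on a closed subset of $X$, with values in $Y$) extends to a map from the entire space $X$ to $Y$ that is also carried by $C$.
   Context: Maps are continuous. A space $Z$ is an absolute extensor for a space $X$ if each map from a closed subset of $X$ into $Z$ extends over all of $X$; $AE(X)$ is the class of absolute extensors for $X$. Convention: the empty set is counted as a member of $AE(X)$ (i.e. only non-empty closed subsets are considered in the definition; for non-empty $Z$ this makes no difference). For a class $\mathcal{C}$ of topological spaces, a cover is a $\mathcal{C}$-cover if the intersection of each non-empty collection of its elements belongs to $\mathcal{C}$. A cover is closed if all its elements are closed. A cover is locally finite dimensional if its nerve is locally finite dimensional, i.e. for each element $F$ of the cover there is a finite bound on the cardinality of finite subcollections containing $F$ that have non-empty intersection. A carrier is a function $C \colon \mathcal{F} \to \mathcal{G}$ from a cover $\mathcal{F}$ of a space $X$ into a collection $\mathcal{G}$ of subsets of a topological space such that for each (non-empty) $\mathcal{A} \subset \mathcal{F}$, if $\bigcap \mathcal{A} \neq \emptyset$, then $\bigcap_{A \in \mathcal{A}} C(A) \neq \emptyset$. A map $f$ is carried by $C$ if its domain $\operatorname{dom} f$ is a closed subset of $X$ and $f(F \cap \operatorname{dom} f) \subset C(F)$ for each $F \in \mathcal{F}$. *)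

theory Defs
  imports "HOL-Analysis.Abstract_Topology"
begin

definition cover_of :: "'a topology \<Rightarrow> 'a set set \<Rightarrow> bool" where
  "cover_of X \<F> \<longleftrightarrow> \<Union>\<F> = topspace X"

definition closed_cover :: "'a topology \<Rightarrow> 'a set set \<Rightarrow> bool" where
  "closed_cover X \<F> \<longleftrightarrow> cover_of X \<F> \<and> (\<forall>F\<in>\<F>. closedin X F)"

(* Only non-empty closed subsets A are tested, so that the empty space is an
   absolute extensor for every X. *)
definition absolute_extensor :: "'a topology \<Rightarrow> 'b topology \<Rightarrow> bool" where
  "absolute_extensor X Z \<longleftrightarrow>
     (\<forall>A f. closedin X A \<and> A \<noteq> {} \<and> continuous_map (subtopology X A) Z f \<longrightarrow>
        (\<exists>g. continuous_map X Z g \<and> (\<forall>x\<in>A. g x = f x)))"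

(* The class of spaces is given by a predicate P; the members of P are tested on
   intersections of arbitrary, possibly infinite, non-empty subcollections. *)
definition class_cover :: "('b topology \<Rightarrow> bool) \<Rightarrow> 'b topology \<Rightarrow> 'b set set \<Rightarrow> bool" where
  "class_cover P Y \<G> \<longleftrightarrow>
     cover_of Y \<G> \<and> (\<forall>\<A>. \<A> \<subseteq> \<G> \<and> \<A> \<noteq> {} \<longrightarrow> P (subtopology Y (\<Inter>\<A>)))"

definition locally_finite_dimensional :: "'a set set \<Rightarrow> bool" where
  "locally_finite_dimensional \<F> \<longleftrightarrow>
     (\<forall>F\<in>\<F>. \<exists>n::nat. \<forall>\<A>. finite \<A> \<and> \<A> \<subseteq> \<F> \<and> F \<in> \<A> \<and> \<Inter>\<A> \<noteq> {} \<longrightarrow> card \<A> \<le> n)"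

definition is_carrier :: "'a set set \<Rightarrow> 'b set set \<Rightarrow> ('a set \<Rightarrow> 'b set) \<Rightarrow> bool" where
  "is_carrier \<F> \<G> C \<longleftrightarrow>
     C \<in> \<F> \<rightarrow> \<G> \<and>
     (\<forall>\<A>. \<A> \<subseteq> \<F> \<and> \<A> \<noteq> {} \<and> \<Inter>\<A> \<noteq> {} \<longrightarrow> (\<Inter>A\<in>\<A>. C A) \<noteq> {})"

(* HOL functions are total, so the domain D of the partial map f is an explicit
   argument; values of f outside D are irrelevant. *)
definition carried_by ::
  "'a topology \<Rightarrow> 'b topology \<Rightarrow> 'a set set \<Rightarrow> ('a set \<Rightarrow> 'b set) \<Rightarrow> 'a set \<Rightarrow> ('a \<Rightarrow> 'b) \<Rightarrow> bool" where
  "carried_by X Y \<F> C D f \<longleftrightarrow>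
     closedin X D \<and> continuous_map (subtopology X D) Y f \<and>
     (\<forall>F\<in>\<F>. f ` (F \<inter> D) \<subseteq> C F)"

end

theory Submission
  imports Defs "HOL-Analysis.Abstract_Topology_2"
begin

text \<open>
  The map is extended over the intersections \<open>\<Inter>\<A>\<close> of the simplices \<open>\<A>\<close> of the nerve of
  \<open>\<F>\<close>, in order of increasing \<^emph>\<open>codimension\<close>: the largest number of vertices that can be
  added to \<open>\<A>\<close> inside the nerve. Maximal simplices have codimension 0, and local finite
  dimensionality says exactly that every codimension is finite, so the induction starts at the
  small, deep intersections and works outwards until it reaches the single members of \<open>\<F>\<close>,
  which cover \<open>X\<close>.

  When \<open>\<A>\<close> is reached, a value has already been chosen at each point of \<open>\<Inter>\<A>\<close> that lies in
  \<open>D\<close> or in a further member of \<open>\<F>\<close>, because adding a vertex lowers the codimension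
  (lemma \<open>codim_less\<close>). This has two consequences. First, a point of \<open>\<Inter>\<A>\<close> where the value
  is still free lies in no member of \<open>\<F>\<close> outside \<open>\<A>\<close>, so the only constraint there is to stay
  in \<open>\<Inter>(C ` \<A>)\<close>, which is a non-empty absolute extensor; it provides the extension
  (lemma \<open>extend_over_simplex\<close>). Secondly, two simplices of the same codimension compete
  for no point, so their extensions can be glued simultaneously (lemma \<open>extend_to_next_stage\<close>).
  Continuity of the glued maps, and of the limit of the stages, comes from local finiteness,
  which passes from \<open>\<F>\<close> to the family of intersections of its simplices.
\<close>

section \<open>The nerve of a cover and codimension\<close>

definition nerve :: "'a set set \<Rightarrow> 'a set set set" where
  "nerve \<F> = {\<A>. \<A> \<subseteq> \<F> \<and> finite \<A> \<and> \<A> \<noteq> {} \<and> \<Inter>\<A> \<noteq> {}}"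

definition codim :: "'a set set \<Rightarrow> 'a set set \<Rightarrow> nat" where
  "codim \<F> \<A> = Max ((\<lambda>\<B>. card (\<B> - \<A>)) ` {\<B>\<in>nerve \<F>. \<A> \<subseteq> \<B>})"

lemma finite_card_over_simplex:
  assumes lfd: "locally_finite_dimensional \<F>" and A: "\<A> \<in> nerve \<F>"
  shows "finite ((\<lambda>\<B>. card (\<B> - \<A>)) ` {\<B>\<in>nerve \<F>. \<A> \<subseteq> \<B>})"
proof -
  obtain F where F: "F \<in> \<A>" "F \<in> \<F>"
    using A by (auto simp: nerve_def)
  then obtain n :: nat
    where n: "\<And>\<B>. finite \<B> \<Longrightarrow> \<B> \<subseteq> \<F> \<Longrightarrow> F \<in> \<B> \<Longrightarrow> \<Inter>\<B> \<noteq> {} \<Longrightarrow> card \<B> \<le> n"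
    using lfd unfolding locally_finite_dimensional_def by meson
  have "card (\<B> - \<A>) \<le> n" if "\<B> \<in> nerve \<F>" "\<A> \<subseteq> \<B>" for \<B>
  proof -
    have "card (\<B> - \<A>) \<le> card \<B>"
      using that by (intro card_mono) (auto simp: nerve_def)
    also have "card \<B> \<le> n"
      using that F by (intro n) (auto simp: nerve_def)
    finally show ?thesis .
  qed
  then show ?thesis
    by (auto simp: finite_nat_set_iff_bounded_le)
qed

text \<open>
  Anything that can be added to the larger simplex can be added to the smaller one together
  with the vertices in which they differ.
\<close>

lemma codim_less:
  assumes lfd: "locally_finite_dimensional \<F>"
    and A: "\<A> \<in> nerve \<F>" and B: "\<B> \<in> nerve \<F>" and AB: "\<A> \<subset> \<B>"
  shows "codim \<F> \<B> < codim \<F> \<A>"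
proof -
  have "codim \<F> \<B> \<in> (\<lambda>\<E>. card (\<E> - \<B>)) ` {\<E>\<in>nerve \<F>. \<B> \<subseteq> \<E>}"
    unfolding codim_def using finite_card_over_simplex[OF lfd B] B by (intro Max_in) auto
  then obtain \<E> where E: "\<E> \<in> nerve \<F>" "\<B> \<subseteq> \<E>" "codim \<F> \<B> = card (\<E> - \<B>)"
    by blast
  have "card (\<E> - \<B>) < card (\<E> - \<A>)"
    using E AB by (intro psubset_card_mono) (auto simp: nerve_def)
  also have "card (\<E> - \<A>) \<le> codim \<F> \<A>"
    unfolding codim_def using E AB
    by (intro Max_ge finite_card_over_simplex[OF lfd A]) auto
  finally show ?thesis
    using E by simp
qed

section \<open>Local finiteness and gluing\<close>

text \<open>
  A neighbourhood that meets finitely many members of the cover meets the intersection of a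
  simplex only if it meets all vertices, and finitely many sets have finitely many subsets.
\<close>

lemma locally_finite_in_Inter_nerve:
  assumes lf: "locally_finite_in X \<F>"
  shows "locally_finite_in X (Inter ` nerve \<F>)"
  unfolding locally_finite_in_def
proof (intro conjI ballI)
  show "\<Union>(Inter ` nerve \<F>) \<subseteq> topspace X"
  proof
    fix x
    assume "x \<in> \<Union>(Inter ` nerve \<F>)"
    then obtain \<A> F where "\<A> \<in> nerve \<F>" "x \<in> \<Inter>\<A>" "F \<in> \<A>"
      by (auto simp: nerve_def)
    then have "x \<in> \<Union>\<F>"
      by (auto simp: nerve_def)
    then show "x \<in> topspace X"
      using lf unfolding locally_finite_in_def by blast
  qed
next
  fix x
  assume "x \<in> topspace X"
  then obtain V where V: "openin X V" "x \<in> V" "finite {U\<in>\<F>. U \<inter> V \<noteq> {}}"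
    using lf unfolding locally_finite_in_def by blast
  have "{U \<in> Inter ` nerve \<F>. U \<inter> V \<noteq> {}} \<subseteq> Inter ` Pow {U\<in>\<F>. U \<inter> V \<noteq> {}}"
    unfolding nerve_def by blast
  then have "finite {U \<in> Inter ` nerve \<F>. U \<inter> V \<noteq> {}}"
    by (rule finite_subset) (intro finite_imageI V(3) finite_Pow_iff[THEN iffD2])
  with V show "\<exists>V. openin X V \<and> x \<in> V \<and> finite {U \<in> Inter ` nerve \<F>. U \<inter> V \<noteq> {}}"
    by blast
qed

lemma locally_finite_in_insert:
  assumes "locally_finite_in X \<P>" and "S \<subseteq> topspace X"
  shows "locally_finite_in X (insert S \<P>)"
  unfolding locally_finite_in_def
proof (intro conjI ballI)
  show "\<Union>(insert S \<P>) \<subseteq> topspace X"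
    using assms by (auto simp: locally_finite_in_def)
next
  fix x
  assume "x \<in> topspace X"
  then obtain V where V: "openin X V" "x \<in> V" "finite {U\<in>\<P>. U \<inter> V \<noteq> {}}"
    using assms unfolding locally_finite_in_def by blast
  have "finite {U \<in> insert S \<P>. U \<inter> V \<noteq> {}}"
    by (rule finite_subset[OF _ finite.insertI[OF V(3), of S]]) auto
  with V show "\<exists>V. openin X V \<and> x \<in> V \<and> finite {U \<in> insert S \<P>. U \<inter> V \<noteq> {}}"
    by blast
qed

lemma continuous_map_on_locally_finite_Union:
  assumes lf: "locally_finite_in X \<P>"
    and clo: "\<And>S. S \<in> \<P> \<Longrightarrow> closedin X S"
    and cont: "\<And>S. S \<in> \<P> \<Longrightarrow> continuous_map (subtopology X S) Y g"
  shows "continuous_map (subtopology X (\<Union>\<P>)) Y g"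
proof (rule pasting_lemma_locally_finite[where I = \<P> and T = "\<lambda>S. S" and f = "\<lambda>_. g"])
  show "\<exists>V. openin (subtopology X (\<Union>\<P>)) V \<and> x \<in> V \<and> finite {S\<in>\<P>. S \<inter> V \<noteq> {}}"
    if "x \<in> topspace (subtopology X (\<Union>\<P>))" for x
    using locally_finite_in_subtopology[OF lf subset_refl] that
    unfolding locally_finite_in_def by blast
  show "closedin (subtopology X (\<Union>\<P>)) S" if "S \<in> \<P>" for S
    using clo[OF that] that by (auto intro: closedin_subset_topspace)
  show "continuous_map (subtopology (subtopology X (\<Union>\<P>)) S) Y g" if "S \<in> \<P>" for S
  proof -
    have "\<Union>\<P> \<inter> S = S"
      using that by blast
    then show ?thesis
      using cont[OF that] by (simp add: subtopology_subtopology)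
  qed
qed auto

section \<open>Extending over the intersection of one simplex\<close>

text \<open>
  If \<open>\<Inter>\<A>\<close> misses \<open>E\<close>, there is nothing to extend, and a constant map takes the place
  of the extension; this is where the carrier condition is needed.
\<close>

lemma extend_over_simplex:
  assumes clo: "\<And>F. F \<in> \<F> \<Longrightarrow> closedin X F"
    and ae: "class_cover (absolute_extensor X) Y \<G>"
    and carrier: "is_carrier \<F> \<G> C"
    and g: "carried_by X Y \<F> C E g"
    and A: "\<A> \<in> nerve \<F>"
  shows "\<exists>h. continuous_map (subtopology X (\<Inter>\<A>)) Y h \<and> h ` \<Inter>\<A> \<subseteq> \<Inter>(C ` \<A>)
           \<and> (\<forall>x\<in>\<Inter>\<A> \<inter> E. h x = g x)"
proof -
  let ?Z = "subtopology Y (\<Inter>(C ` \<A>))"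
  have A': "\<A> \<subseteq> \<F>" "\<A> \<noteq> {}" "\<Inter>\<A> \<noteq> {}"
    using A by (auto simp: nerve_def)
  have CA: "C ` \<A> \<subseteq> \<G>" "C ` \<A> \<noteq> {}"
    using carrier A' unfolding is_carrier_def by auto
  then have Z: "absolute_extensor X ?Z"
    using ae unfolding class_cover_def by blast
  have cloA: "closedin X (\<Inter>\<A>)"
    using A' clo by (intro closedin_Inter) auto
  have cloE: "closedin X E" and contE: "continuous_map (subtopology X E) Y g"
    and gC: "\<And>F. F \<in> \<F> \<Longrightarrow> g ` (F \<inter> E) \<subseteq> C F"
    using g unfolding carried_by_def by auto
  have "\<exists>h. continuous_map X ?Z h \<and> (\<forall>x\<in>\<Inter>\<A> \<inter> E. h x = g x)"
  proof (cases "\<Inter>\<A> \<inter> E = {}")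
    case True
    obtain y where y: "y \<in> \<Inter>(C ` \<A>)"
      using carrier A' unfolding is_carrier_def by blast
    have "\<Union>\<G> = topspace Y"
      using ae unfolding class_cover_def cover_of_def by blast
    with y CA have "y \<in> topspace ?Z"
      by auto
    then have "continuous_map X ?Z (\<lambda>_. y)"
      by simp
    then show ?thesis
      using True by blast
  next
    case False
    have "continuous_map (subtopology X (\<Inter>\<A> \<inter> E)) Y g"
      using contE by (rule continuous_map_from_subtopology_mono) auto
    moreover have "g ` (\<Inter>\<A> \<inter> E) \<subseteq> \<Inter>(C ` \<A>)"
      using gC A' by blast
    ultimately have "continuous_map (subtopology X (\<Inter>\<A> \<inter> E)) ?Z g"
      by (auto simp: continuous_map_in_subtopology)
    moreover have "closedin X (\<Inter>\<A> \<inter> E)"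
      using cloA cloE by blast
    ultimately show ?thesis
      using Z False unfolding absolute_extensor_def by blast
  qed
  then obtain h where h: "continuous_map X ?Z h" "\<And>x. x \<in> \<Inter>\<A> \<inter> E \<Longrightarrow> h x = g x"
    by blast
  then have "continuous_map X Y h" and hC: "h ` topspace X \<subseteq> \<Inter>(C ` \<A>)"
    by (auto simp: continuous_map_in_subtopology)
  then have "continuous_map (subtopology X (\<Inter>\<A>)) Y h"
    by (simp add: continuous_map_from_subtopology)
  moreover have "h ` \<Inter>\<A> \<subseteq> \<Inter>(C ` \<A>)"
    using hC closedin_subset[OF cloA] by blast
  ultimately show ?thesis
    using h(2) by (intro exI[of _ h] conjI ballI)
qed

section \<open>Induction on codimension\<close>

definition stage :: "'a set set \<Rightarrow> 'a set \<Rightarrow> nat \<Rightarrow> 'a set" where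
  "stage \<F> D k = D \<union> \<Union>(Inter ` {\<A>\<in>nerve \<F>. codim \<F> \<A> < k})"

lemma stage_Suc:
  "stage \<F> D (Suc k) = \<Union>(insert (stage \<F> D k) (Inter ` {\<A>\<in>nerve \<F>. codim \<F> \<A> = k}))"
proof -
  have "{\<A>\<in>nerve \<F>. codim \<F> \<A> < Suc k}
      = {\<A>\<in>nerve \<F>. codim \<F> \<A> < k} \<union> {\<A>\<in>nerve \<F>. codim \<F> \<A> = k}"
    by (auto simp: less_Suc_eq)
  then show ?thesis
    unfolding stage_def by (simp only: image_Un Union_Un_distrib Union_insert Un_assoc)
qed

lemma stage_mono: "j \<le> k \<Longrightarrow> stage \<F> D j \<subseteq> stage \<F> D k"
  unfolding stage_def by (intro Un_mono Union_mono image_mono order_refl) auto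

lemma simplex_subset_stage:
  "\<A> \<in> nerve \<F> \<Longrightarrow> codim \<F> \<A> < k \<Longrightarrow> \<Inter>\<A> \<subseteq> stage \<F> D k"
  unfolding stage_def by blast

text \<open>
  Enlarging a simplex lowers its codimension, so only points of the current stage can belong
  to a vertex outside a simplex of codimension \<open>k\<close> that contains them.
\<close>

lemma in_stage_if_in_other_vertex:
  assumes lfd: "locally_finite_dimensional \<F>"
    and A: "\<A> \<in> nerve \<F>" "codim \<F> \<A> = k" "x \<in> \<Inter>\<A>"
    and F: "F \<in> \<F>" "x \<in> F" "F \<notin> \<A>"
  shows "x \<in> stage \<F> D k"
proof -
  have "insert F \<A> \<in> nerve \<F>"
    using A F by (auto simp: nerve_def)
  moreover from this have "codim \<F> (insert F \<A>) < k"
    using codim_less[OF lfd A(1), of "insert F \<A>"] A F by auto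
  ultimately have "\<Inter>(insert F \<A>) \<subseteq> stage \<F> D k"
    by (rule simplex_subset_stage)
  then show ?thesis
    using A F by auto
qed

lemma extend_to_next_stage:
  assumes clo: "\<And>F. F \<in> \<F> \<Longrightarrow> closedin X F"
    and lf: "locally_finite_in X \<F>"
    and lfd: "locally_finite_dimensional \<F>"
    and ae: "class_cover (absolute_extensor X) Y \<G>"
    and carrier: "is_carrier \<F> \<G> C"
    and g: "carried_by X Y \<F> C (stage \<F> D k) g"
  shows "\<exists>g'. carried_by X Y \<F> C (stage \<F> D (Suc k)) g' \<and> (\<forall>x\<in>stage \<F> D k. g' x = g x)"
proof -
  let ?E = "stage \<F> D k"
  let ?N = "{\<A>\<in>nerve \<F>. codim \<F> \<A> = k}"
  have "\<exists>h. continuous_map (subtopology X (\<Inter>\<A>)) Y h \<and> h ` \<Inter>\<A> \<subseteq> \<Inter>(C ` \<A>)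
           \<and> (\<forall>x\<in>\<Inter>\<A> \<inter> ?E. h x = g x)" if "\<A> \<in> ?N" for \<A>
    using that by (intro extend_over_simplex[OF clo ae carrier g]) auto
  then obtain h where
    hcont: "\<And>\<A>. \<A> \<in> ?N \<Longrightarrow> continuous_map (subtopology X (\<Inter>\<A>)) Y (h \<A>)" and
    hC: "\<And>\<A>. \<A> \<in> ?N \<Longrightarrow> h \<A> ` \<Inter>\<A> \<subseteq> \<Inter>(C ` \<A>)" and
    hg: "\<And>\<A> x. \<A> \<in> ?N \<Longrightarrow> x \<in> \<Inter>\<A> \<Longrightarrow> x \<in> ?E \<Longrightarrow> h \<A> x = g x"
    by (metis (no_types, lifting) IntI)
  have unique: "\<A> = \<B>"
    if "\<A> \<in> ?N" "\<B> \<in> ?N" "x \<in> \<Inter>\<A>" "x \<in> \<Inter>\<B>" "x \<notin> ?E" for \<A> \<B> x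
  proof -
    have sub: "\<B>' \<subseteq> \<A>'" if "\<A>' \<in> ?N" "\<B>' \<in> ?N" "x \<in> \<Inter>\<A>'" "x \<in> \<Inter>\<B>'" for \<A>' \<B>'
    proof
      fix F
      assume F: "F \<in> \<B>'"
      then have "F \<in> \<F>" "x \<in> F"
        using that by (auto simp: nerve_def)
      then show "F \<in> \<A>'"
        using in_stage_if_in_other_vertex[OF lfd, of \<A>' k x F D] that \<open>x \<notin> ?E\<close> by blast
    qed
    show ?thesis
      using sub[of \<A> \<B>] sub[of \<B> \<A>] that by blast
  qed
  define g' where "g' x = (if x \<in> ?E then g x else h (THE \<A>. \<A> \<in> ?N \<and> x \<in> \<Inter>\<A>) x)" for x
  have g'_E: "g' x = g x" if "x \<in> ?E" for x
    using that by (simp add: g'_def)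
  have g'_h: "g' x = h \<A> x" if "\<A> \<in> ?N" "x \<in> \<Inter>\<A>" for \<A> x
  proof (cases "x \<in> ?E")
    case True
    then show ?thesis
      using hg[OF that] g'_E by simp
  next
    case False
    then have "(THE \<A>. \<A> \<in> ?N \<and> x \<in> \<Inter>\<A>) = \<A>"
      using that unique by (intro the_equality) blast+
    then show ?thesis
      using False unfolding g'_def by simp
  qed
  let ?P = "insert ?E (Inter ` ?N)"
  have cloE: "closedin X ?E" and gcont: "continuous_map (subtopology X ?E) Y g"
    and gC: "\<And>F. F \<in> \<F> \<Longrightarrow> g ` (F \<inter> ?E) \<subseteq> C F"
    using g unfolding carried_by_def by auto
  have cloP: "closedin X S" if "S \<in> ?P" for S
    using that cloE clo by (auto simp: nerve_def intro!: closedin_Inter)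
  have "locally_finite_in X (Inter ` ?N)"
    using locally_finite_in_Inter_nerve[OF lf] by (rule locally_finite_in_subset) auto
  then have lfP: "locally_finite_in X ?P"
    using closedin_subset[OF cloE] by (rule locally_finite_in_insert)
  have contP: "continuous_map (subtopology X S) Y g'" if "S \<in> ?P" for S
  proof (cases "S = ?E")
    case True
    then show ?thesis
      using gcont g'_E by (auto intro: continuous_map_eq)
  next
    case False
    then obtain \<A> where A: "\<A> \<in> ?N" "S = \<Inter>\<A>"
      using \<open>S \<in> ?P\<close> by blast
    have "h \<A> x = g' x" if "x \<in> topspace (subtopology X S)" for x
      using that g'_h[OF A(1)] A(2) by simp
    then show ?thesis
      using hcont[OF A(1)] A(2) by (auto intro: continuous_map_eq)
  qed
  have "g' x \<in> C F" if F: "F \<in> \<F>" "x \<in> F" and x: "x \<in> \<Union>?P" for F x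
  proof (cases "x \<in> ?E")
    case True
    then show ?thesis
      using gC[OF F(1)] F g'_E by auto
  next
    case False
    then obtain \<A> where A: "\<A> \<in> ?N" "x \<in> \<Inter>\<A>"
      using x by blast
    have "F \<in> \<A>"
      using in_stage_if_in_other_vertex[OF lfd, of \<A> k x F D] A F False by blast
    then show ?thesis
      using hC[OF A(1)] g'_h[OF A] A by auto
  qed
  then have "carried_by X Y \<F> C (\<Union>?P) g'"
    unfolding carried_by_def
    using closedin_locally_finite_Union[OF cloP lfP]
      continuous_map_on_locally_finite_Union[OF lfP cloP contP]
    by blast
  then show ?thesis
    unfolding stage_Suc using g'_E by blast
qed

text \<open>
  The maps on the stages agree on overlaps and hence have a union. A single vertex \<open>F\<close> is a
  simplex of finite codimension, so \<open>F\<close> lies in one stage and the union is continuous on \<open>F\<close>.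
\<close>

theorem mainTheorem1:
  fixes X :: "'a topology" and Y :: "'b topology"
    and \<F> :: "'a set set" and \<G> :: "'b set set"
    and C :: "'a set \<Rightarrow> 'b set"
    and D :: "'a set" and f :: "'a \<Rightarrow> 'b"
  assumes "closed_cover X \<F>"
    and "locally_finite_in X \<F>"
    and "locally_finite_dimensional \<F>"
    and "class_cover (absolute_extensor X) Y \<G>"
    and "is_carrier \<F> \<G> C"
    and "carried_by X Y \<F> C D f"
  shows "\<exists>g. carried_by X Y \<F> C (topspace X) g \<and> (\<forall>x\<in>D. g x = f x)"
proof -
  have clo: "\<And>F. F \<in> \<F> \<Longrightarrow> closedin X F" and cover: "\<Union>\<F> = topspace X"
    using assms(1) by (auto simp: closed_cover_def cover_of_def)
  have stage0: "stage \<F> D 0 = D"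
    by (simp add: stage_def)
  let ?good = "\<lambda>k g. carried_by X Y \<F> C (stage \<F> D k) g \<and> (\<forall>x\<in>D. g x = f x)"
  have "\<exists>G. \<forall>k. ?good k (G k) \<and> (\<forall>x\<in>stage \<F> D k. G (Suc k) x = G k x)"
  proof (rule dependent_nat_choice)
    show "\<exists>g. ?good 0 g"
      using assms(6) stage0 by auto
  next
    fix g k
    assume g: "?good k g"
    then obtain g' where "carried_by X Y \<F> C (stage \<F> D (Suc k)) g'"
      and "\<forall>x\<in>stage \<F> D k. g' x = g x"
      using extend_to_next_stage[OF clo assms(2-5)] by blast
    moreover have "D \<subseteq> stage \<F> D k"
      by (simp add: stage_def)
    ultimately show "\<exists>g'. ?good (Suc k) g' \<and> (\<forall>x\<in>stage \<F> D k. g' x = g x)"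
      using g by (intro exI[of _ g']) auto
  qed
  then obtain G where G: "\<And>k. carried_by X Y \<F> C (stage \<F> D k) (G k)"
    and Gf: "\<And>k x. x \<in> D \<Longrightarrow> G k x = f x"
    and G_Suc: "\<And>k x. x \<in> stage \<F> D k \<Longrightarrow> G (Suc k) x = G k x"
    by metis
  have agree: "G k x = G j x" if "j \<le> k" "x \<in> stage \<F> D j" for j k x
    using that(1)
  proof (induction k rule: dec_induct)
    case (step n)
    have "x \<in> stage \<F> D n"
      using stage_mono[OF step(1), of \<F> D] that(2) by blast
    then show ?case
      using step.IH G_Suc by simp
  qed simp
  define g where "g x = G (LEAST k. x \<in> stage \<F> D k) x" for x
  have g: "g x = G k x" if "x \<in> stage \<F> D k" for k x
    unfolding g_def
    by (rule agree[symmetric]) (use that in \<open>auto intro: Least_le LeastI\<close>)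
  have g_on_vertex: "continuous_map (subtopology X F) Y g \<and> g ` F \<subseteq> C F" if F: "F \<in> \<F>" for F
  proof (cases "F = {}")
    case True
    then show ?thesis
      by (simp add: continuous_map_on_empty)
  next
    case False
    define k where "k = Suc (codim \<F> {F})"
    have "{F} \<in> nerve \<F>"
      using F False by (auto simp: nerve_def)
    then have sub: "F \<subseteq> stage \<F> D k"
      using simplex_subset_stage[of "{F}" \<F> k D] by (simp add: k_def)
    have "continuous_map (subtopology X F) Y (G k)"
      using G[of k] sub unfolding carried_by_def
      by (blast intro: continuous_map_from_subtopology_mono)
    then have "continuous_map (subtopology X F) Y g"
      by (rule continuous_map_eq) (use sub g in auto)
    moreover have "G k ` (F \<inter> stage \<F> D k) \<subseteq> C F"
      using G[of k] F unfolding carried_by_def by blast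
    then have "g ` F \<subseteq> C F"
      using sub g by force
    ultimately show ?thesis
      by blast
  qed
  have "continuous_map (subtopology X (\<Union>\<F>)) Y g"
    using g_on_vertex by (intro continuous_map_on_locally_finite_Union[OF assms(2) clo]) auto
  then have "carried_by X Y \<F> C (topspace X) g"
    unfolding carried_by_def using cover g_on_vertex by auto
  moreover have "g x = f x" if "x \<in> D" for x
    using g[of x 0] that stage0 Gf by simp
  ultimately show ?thesis
    by blast
qed

end
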